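(* Let $p>q>2$ be prime numbers with $p\equiv1\pmod q$, let $g$ be an integer whose multiplicative order modulo $p$ is $q$, and let $G=\{\sigma^i\tau^j\mid 0\le i\le p-1,\ 0\le j\le q-1\}$ be the nonabelian group of order $pq$ with $\sigma$ of order $p$, $\tau$ of order $q$ and $\tau\sigma\tau^{-1}=\sigma^g$. Let $\psi\in\mathrm{Aut}(G)$ be given by $\psi(\sigma)=\sigma$, $\psi(\tau)=\sigma\tau$. For $2\le t\le q-1$ let $N_t=\langle\eta,\pi_t\rangle$ and $N_t^{opp}=\langle\eta_t,\pi\rangle$ be the subgroups of $\mathrm{Perm}(G)$ generated by the permutations $$\eta(\sigma^k\tau^\ell)=\sigma^{k+1}\tau^\ell,\quad \pi_t(\sigma^k\tau^\ell)=\sigma^{kg^t}\tau^{\ell+1},\quad \eta_t(\sigma^k\tau^\ell)=\sigma^{k+g^{\ell t}}\tau^\ell,\quad \pi(\sigma^k\tau^\ell)=\sigma^k\tau^{\ell+1},$$ and for $0\le u\le p-1$ let $N_{t,u}=\psi^{-u}N_t\psi^u$ and $N^{opp}_{t,u}=\psi^{-u}N^{opp}_t\psi^u$. Then, with $t,t_1,t_2$ ranging over $\{2,\dots,q-1\}$ and $u,u_1,u_2$ over $\{0,\dots,p-1\}$: the subgroups $N_{t,u}$ are mutually $G$-isomorphic; the $G$-isomorphism classes amongst the subgroups $N^{opp}_{t,u}$ are determined by $t$, i.e. $N^{opp}_{t_1,u_1}$ and $N^{opp}_{t_2,u_2}$ are $G$-isomorphic if and only if $t_1=t_2$; and no subgroup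 of the form $N_{t_1,u_1}$ is $G$-isomorphic to a subgroup of the form $N^{opp}_{t_2,u_2}$.
   Context: $\mathrm{Perm}(G)$ is the group of permutations of $G$ and $\lambda(x)[y]=xy$. $G$ acts on $\mathrm{Perm}(G)$ by ${}^{x}\pi=\lambda(x)\pi\lambda(x)^{-1}$. A subgroup of $\mathrm{Perm}(G)$ is regular if it acts transitively on $G$ with trivial stabilizers, and $G$-stable if it is preserved by this action. Two regular $G$-stable subgroups $N,M$ are $G$-isomorphic if there is a group isomorphism $\theta:N\to M$ with $\theta({}^{x}\nu)={}^{x}\theta(\nu)$ for all $\nu\in N$, $x\in G$. The subgroups $N_{t,u}$ and $N^{opp}_{t,u}$ are regular, $G$-stable and isomorphic to $G$. Automorphisms of $G$ are regarded as elements of $\mathrm{Perm}(G)$. *)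

theory Defs
  imports
    "HOL-Algebra.Group_Action"
    "HOL-Algebra.Generated_Groups"
    "HOL-Number_Theory.Number_Theory"
begin

text \<open>The product in \<open>BijGroup\<close> is composition, the right factor being applied first.\<close>

definition Perm :: "('a, 'b) monoid_scheme \<Rightarrow> ('a \<Rightarrow> 'a) monoid"
  where "Perm G = BijGroup (carrier G)"

definition left_transl :: "('a, 'b) monoid_scheme \<Rightarrow> 'a \<Rightarrow> 'a \<Rightarrow> 'a"
  where "left_transl G x = (\<lambda>y\<in>carrier G. x \<otimes>\<^bsub>G\<^esub> y)"

definition G_act :: "('a, 'b) monoid_scheme \<Rightarrow> 'a \<Rightarrow> ('a \<Rightarrow> 'a) \<Rightarrow> 'a \<Rightarrow> 'a"
  where "G_act G x \<nu> =
    left_transl G x \<otimes>\<^bsub>Perm G\<^esub> \<nu> \<otimes>\<^bsub>Perm G\<^esub> inv\<^bsub>Perm G\<^esub> (left_transl G x)"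

definition regular_subgroup :: "('a, 'b) monoid_scheme \<Rightarrow> ('a \<Rightarrow> 'a) set \<Rightarrow> bool"
  where "regular_subgroup G N \<longleftrightarrow>
    subgroup N (Perm G) \<and>
    transitive_action (Perm G\<lparr>carrier := N\<rparr>) (carrier G) (\<lambda>\<nu>. \<nu>) \<and>
    (\<forall>x\<in>carrier G. stabilizer (Perm G\<lparr>carrier := N\<rparr>) (\<lambda>\<nu>. \<nu>) x = {\<one>\<^bsub>Perm G\<^esub>})"

definition G_stable :: "('a, 'b) monoid_scheme \<Rightarrow> ('a \<Rightarrow> 'a) set \<Rightarrow> bool"
  where "G_stable G N \<longleftrightarrow> (\<forall>x\<in>carrier G. \<forall>\<nu>\<in>N. G_act G x \<nu> \<in> N)"

text \<open>A relation between regular \<open>G\<close>-stable subgroups only: it fails by definition if either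
  side is not of this kind.\<close>

definition G_isomorphic ::
    "('a, 'b) monoid_scheme \<Rightarrow> ('a \<Rightarrow> 'a) set \<Rightarrow> ('a \<Rightarrow> 'a) set \<Rightarrow> bool"
  where "G_isomorphic G N M \<longleftrightarrow>
    regular_subgroup G N \<and> G_stable G N \<and>
    regular_subgroup G M \<and> G_stable G M \<and>
    (\<exists>\<theta> \<in> iso (Perm G\<lparr>carrier := N\<rparr>) (Perm G\<lparr>carrier := M\<rparr>).
       \<forall>\<nu>\<in>N. \<forall>x\<in>carrier G. \<theta> (G_act G x \<nu>) = G_act G x (\<theta> \<nu>))"

text \<open>The function on \<open>G\<close> sending \<open>\<sigma>\<^sup>k \<tau>\<^sup>l\<close> to \<open>F k l\<close> for all natural numbers \<open>k\<close>, \<open>l\<close>.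
  It is only meaningful if \<open>F k l\<close> depends on \<open>\<sigma>\<^sup>k \<tau>\<^sup>l\<close> alone, that is, on the residue classes of
  the exponents; this is the case for each \<open>F\<close> below.\<close>

definition on_normal_form ::
    "('a, 'b) monoid_scheme \<Rightarrow> 'a \<Rightarrow> 'a \<Rightarrow> (nat \<Rightarrow> nat \<Rightarrow> 'a) \<Rightarrow> 'a \<Rightarrow> 'a"
  where "on_normal_form G \<sigma> \<tau> F =
    (\<lambda>x\<in>carrier G. THE y. \<exists>k l. x = \<sigma> [^]\<^bsub>G\<^esub> k \<otimes>\<^bsub>G\<^esub> \<tau> [^]\<^bsub>G\<^esub> l \<and> y = F k l)"

lemma on_normal_form_eq:
  assumes "group G" "\<sigma> \<in> carrier G" "\<tau> \<in> carrier G"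
    and "\<And>k' l'. \<sigma> [^]\<^bsub>G\<^esub> k \<otimes>\<^bsub>G\<^esub> \<tau> [^]\<^bsub>G\<^esub> l = \<sigma> [^]\<^bsub>G\<^esub> k' \<otimes>\<^bsub>G\<^esub> \<tau> [^]\<^bsub>G\<^esub> l'
           \<Longrightarrow> F k l = F k' l'"
  shows "on_normal_form G \<sigma> \<tau> F (\<sigma> [^]\<^bsub>G\<^esub> k \<otimes>\<^bsub>G\<^esub> \<tau> [^]\<^bsub>G\<^esub> l) = F k l"
proof -
  interpret group G by fact
  have "(THE y. \<exists>k' l'. \<sigma> [^]\<^bsub>G\<^esub> k \<otimes>\<^bsub>G\<^esub> \<tau> [^]\<^bsub>G\<^esub> l = \<sigma> [^]\<^bsub>G\<^esub> k' \<otimes>\<^bsub>G\<^esub> \<tau> [^]\<^bsub>G\<^esub> l' \<and> y = F k' l')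
      = F k l"
    using assms(4) by (intro the_equality) (blast, metis)
  then show ?thesis
    using assms(2,3) by (simp add: on_normal_form_def)
qed

definition perm_eta :: "('a, 'b) monoid_scheme \<Rightarrow> 'a \<Rightarrow> 'a \<Rightarrow> 'a \<Rightarrow> 'a"
  where "perm_eta G \<sigma> \<tau> =
    on_normal_form G \<sigma> \<tau> (\<lambda>k l. \<sigma> [^]\<^bsub>G\<^esub> (k + 1) \<otimes>\<^bsub>G\<^esub> \<tau> [^]\<^bsub>G\<^esub> l)"

definition perm_pi_t :: "('a, 'b) monoid_scheme \<Rightarrow> 'a \<Rightarrow> 'a \<Rightarrow> int \<Rightarrow> nat \<Rightarrow> 'a \<Rightarrow> 'a"
  where "perm_pi_t G \<sigma> \<tau> g t =
    on_normal_form G \<sigma> \<tau> (\<lambda>k l. \<sigma> [^]\<^bsub>G\<^esub> (int k * g ^ t) \<otimes>\<^bsub>G\<^esub> \<tau> [^]\<^bsub>G\<^esub> (l + 1))"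

definition perm_eta_t :: "('a, 'b) monoid_scheme \<Rightarrow> 'a \<Rightarrow> 'a \<Rightarrow> int \<Rightarrow> nat \<Rightarrow> 'a \<Rightarrow> 'a"
  where "perm_eta_t G \<sigma> \<tau> g t =
    on_normal_form G \<sigma> \<tau> (\<lambda>k l. \<sigma> [^]\<^bsub>G\<^esub> (int k + g ^ (l * t)) \<otimes>\<^bsub>G\<^esub> \<tau> [^]\<^bsub>G\<^esub> l)"

definition perm_pi :: "('a, 'b) monoid_scheme \<Rightarrow> 'a \<Rightarrow> 'a \<Rightarrow> 'a \<Rightarrow> 'a"
  where "perm_pi G \<sigma> \<tau> =
    on_normal_form G \<sigma> \<tau> (\<lambda>k l. \<sigma> [^]\<^bsub>G\<^esub> k \<otimes>\<^bsub>G\<^esub> \<tau> [^]\<^bsub>G\<^esub> (l + 1))"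

definition sub_N :: "('a, 'b) monoid_scheme \<Rightarrow> 'a \<Rightarrow> 'a \<Rightarrow> int \<Rightarrow> nat \<Rightarrow> ('a \<Rightarrow> 'a) set"
  where "sub_N G \<sigma> \<tau> g t = generate (Perm G) {perm_eta G \<sigma> \<tau>, perm_pi_t G \<sigma> \<tau> g t}"

definition sub_Nopp :: "('a, 'b) monoid_scheme \<Rightarrow> 'a \<Rightarrow> 'a \<Rightarrow> int \<Rightarrow> nat \<Rightarrow> ('a \<Rightarrow> 'a) set"
  where "sub_Nopp G \<sigma> \<tau> g t = generate (Perm G) {perm_eta_t G \<sigma> \<tau> g t, perm_pi G \<sigma> \<tau>}"

definition conj_pow ::
    "('a, 'b) monoid_scheme \<Rightarrow> ('a \<Rightarrow> 'a) \<Rightarrow> nat \<Rightarrow> ('a \<Rightarrow> 'a) set \<Rightarrow> ('a \<Rightarrow> 'a) set"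
  where "conj_pow G \<psi> u N =
    (\<lambda>\<nu>. \<psi> [^]\<^bsub>Perm G\<^esub> (- int u) \<otimes>\<^bsub>Perm G\<^esub> \<nu> \<otimes>\<^bsub>Perm G\<^esub> \<psi> [^]\<^bsub>Perm G\<^esub> int u) ` N"

definition N_tu ::
    "('a, 'b) monoid_scheme \<Rightarrow> 'a \<Rightarrow> 'a \<Rightarrow> int \<Rightarrow> ('a \<Rightarrow> 'a) \<Rightarrow> nat \<Rightarrow> nat \<Rightarrow> ('a \<Rightarrow> 'a) set"
  where "N_tu G \<sigma> \<tau> g \<psi> t u = conj_pow G \<psi> u (sub_N G \<sigma> \<tau> g t)"

definition Nopp_tu ::
    "('a, 'b) monoid_scheme \<Rightarrow> 'a \<Rightarrow> 'a \<Rightarrow> int \<Rightarrow> ('a \<Rightarrow> 'a) \<Rightarrow> nat \<Rightarrow> nat \<Rightarrow> ('a \<Rightarrow> 'a) set"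
  where "Nopp_tu G \<sigma> \<tau> g \<psi> t u = conj_pow G \<psi> u (sub_Nopp G \<sigma> \<tau> g t)"

end

theory Submission
  imports Defs
begin

text \<open>
  Conjugating by powers of \<open>\<psi>\<close> does not change the \<open>G\<close>-isomorphism class of a regular
  \<open>G\<close>-stable subgroup \<open>N\<close>. Indeed \<open>\<psi>\<close> is inner: it is conjugation by \<open>\<sigma>\<^sup>c\<close> with
  \<open>c (1 - g) \<equiv> 1\<close> modulo \<open>p\<close>. So \<open>\<psi>\<^sup>u = \<lambda>(z) \<kappa>\<close>, where \<open>z\<close> is a power of \<open>\<sigma>\<close> and \<open>\<kappa>\<close> is a
  right translation. Conjugation by \<open>\<lambda>(z)\<close> maps the stable subgroup \<open>N\<close> to itself, and
  conjugation by \<open>\<kappa>\<close>, which commutes with all left translations, is a \<open>G\<close>-isomorphism from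
  \<open>N\<close> onto its image (\<open>G_isomorphic_conj_pow\<close>, \<open>automorphism_inner\<close>). Only the case \<open>u = 0\<close>
  is left.

  There one computes in the coordinates \<open>(k, l)\<close> of \<open>\<sigma>\<^sup>k \<tau>\<^sup>l\<close>. The elements of \<open>N\<^sub>t\<close> are the maps
  \<open>(k, l) \<mapsto> (g\<^sup>t\<^sup>b k + a, l + b)\<close>, those of \<open>N\<^sub>t\<^sup>o\<^sup>p\<^sup>p\<close> the maps
  \<open>(k, l) \<mapsto> (k + a g\<^sup>t\<^sup>l, l + b)\<close>. On the pairs \<open>(a, b)\<close> the group \<open>G\<close> acts as follows:

  \<^item> on \<open>N\<^sub>t\<close>, \<open>\<sigma>\<close> sends \<open>(a, b)\<close> to \<open>(a + 1 - g\<^sup>t\<^sup>b, b)\<close> and \<open>\<tau>\<close> sends it to \<open>(g a, b)\<close>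
    (\<open>G_act_affine_N\<close>);

  \<^item> on \<open>N\<^sub>t\<^sup>o\<^sup>p\<^sup>p\<close>, \<open>\<sigma>\<close> acts trivially and \<open>\<tau>\<close> sends \<open>(a, b)\<close> to \<open>(g\<^sup>1\<^sup>-\<^sup>t a, b)\<close>
    (\<open>G_act_affine_Nopp\<close>).

  As \<open>t\<^sub>1\<close> and \<open>t\<^sub>2\<close> are prime to \<open>q\<close>, there is a unit \<open>s\<close> with \<open>t\<^sub>2 s \<equiv> t\<^sub>1\<close> modulo \<open>q\<close>; then
  \<open>(a, b) \<mapsto> (a, s b)\<close> is a \<open>G\<close>-isomorphism from \<open>N\<close> for \<open>t\<^sub>1\<close> to \<open>N\<close> for \<open>t\<^sub>2\<close>
  (\<open>G_isomorphic_N\<close>). Since \<open>\<sigma>\<close> moves an element of \<open>N\<^sub>t\<close> but none of any \<open>N\<^sup>o\<^sup>p\<^sup>p\<close>, these are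
  never \<open>G\<close>-isomorphic (\<open>not_G_isomorphic_N_Nopp\<close>). Finally
  (\<open>G_isomorphic_Nopp_imp_cong\<close>), a \<open>G\<close>-isomorphism between two groups \<open>N\<^sup>o\<^sup>p\<^sup>p\<close> respects their
  subgroups of order \<open>p\<close>, on which \<open>\<tau>\<close> acts by the scalar \<open>g\<^sup>1\<^sup>-\<^sup>t\<close>; hence these scalars agree,
  and as \<open>g\<close> has order \<open>q\<close> so do the two parameters modulo \<open>q\<close>.
\<close>

section \<open>Regular stable subgroups of an arbitrary group\<close>

lemma (in group) conjugation_hom: "z \<in> carrier G \<Longrightarrow> (\<lambda>x. z \<otimes> x \<otimes> inv z) \<in> hom G G"
  by (auto simp: hom_def m_assoc inv_solve_left)

lemma (in group) group_Perm: "group (Perm G)"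
  by (simp add: Perm_def group_BijGroup)

context group
begin

interpretation Perm: group "Perm G"
  by (rule group_Perm)

lemma Perm_closed: "\<nu> \<in> carrier (Perm G) \<Longrightarrow> x \<in> carrier G \<Longrightarrow> \<nu> x \<in> carrier G"
  using Bij_imp_funcset by (auto simp: Perm_def BijGroup_def)

lemma Perm_mult_apply:
  "\<lbrakk>\<mu> \<in> carrier (Perm G); \<nu> \<in> carrier (Perm G); x \<in> carrier G\<rbrakk>
    \<Longrightarrow> (\<mu> \<otimes>\<^bsub>Perm G\<^esub> \<nu>) x = \<mu> (\<nu> x)"
  by (simp add: Perm_def BijGroup_def compose_def)

lemma Perm_one_apply: "x \<in> carrier G \<Longrightarrow> \<one>\<^bsub>Perm G\<^esub> x = x"
  by (simp add: Perm_def BijGroup_def)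

lemma Perm_inv_apply:
  assumes "\<nu> \<in> carrier (Perm G)" "x \<in> carrier G"
  shows "(inv\<^bsub>Perm G\<^esub> \<nu>) (\<nu> x) = x"
  using assms by (metis Perm.inv_closed Perm.l_inv Perm_mult_apply Perm_one_apply)

lemma Perm_eqI:
  assumes "\<mu> \<in> carrier (Perm G)" "\<nu> \<in> carrier (Perm G)" "\<And>x. x \<in> carrier G \<Longrightarrow> \<mu> x = \<nu> x"
  shows "\<mu> = \<nu>"
  using assms Bij_imp_extensional by (auto simp: Perm_def BijGroup_def intro: extensionalityI)

lemma left_transl_in_Perm:
  assumes "x \<in> carrier G"
  shows "left_transl G x \<in> carrier (Perm G)"
proof -
  have "bij_betw (left_transl G x) (carrier G) (carrier G)"
    by (rule bij_betwI[where g = "\<lambda>y. inv x \<otimes> y"])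
       (use assms in \<open>auto simp: left_transl_def m_assoc[symmetric]\<close>)
  then show ?thesis
    by (simp add: Perm_def BijGroup_def Bij_def left_transl_def)
qed

text \<open>This turns every computation of the action into an identity between values of permutations:
  \<open>\<mu>\<close> is the conjugate of \<open>\<nu>\<close> by \<open>\<lambda>(x)\<close> as soon as \<open>\<lambda>(x) \<nu> = \<mu> \<lambda>(x)\<close>.\<close>

lemma G_act_eqI:
  assumes "x \<in> carrier G" "\<mu> \<in> carrier (Perm G)" "\<nu> \<in> carrier (Perm G)"
    and "\<And>y. y \<in> carrier G \<Longrightarrow> x \<otimes> \<nu> y = \<mu> (x \<otimes> y)"
  shows "G_act G x \<nu> = \<mu>"
proof -
  note [simp] = left_transl_in_Perm[OF assms(1)]
  have "left_transl G x \<otimes>\<^bsub>Perm G\<^esub> \<nu> = \<mu> \<otimes>\<^bsub>Perm G\<^esub> left_transl G x"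
  proof (rule Perm_eqI)
    fix y assume y: "y \<in> carrier G"
    then show "(left_transl G x \<otimes>\<^bsub>Perm G\<^esub> \<nu>) y = (\<mu> \<otimes>\<^bsub>Perm G\<^esub> left_transl G x) y"
      using assms Perm_closed[OF assms(3) y] by (simp add: Perm_mult_apply) (simp add: left_transl_def)
  qed (use assms in auto)
  then show ?thesis
    using assms by (simp add: G_act_def Perm.m_assoc)
qed

lemma regular_subgroup_iff:
  "regular_subgroup G N \<longleftrightarrow>
    subgroup N (Perm G) \<and>
    (\<forall>x\<in>carrier G. \<forall>y\<in>carrier G. \<exists>\<nu>\<in>N. \<nu> x = y) \<and>
    (\<forall>\<nu>\<in>N. \<forall>x\<in>carrier G. \<nu> x = x \<longrightarrow> \<nu> = \<one>\<^bsub>Perm G\<^esub>)" (is "?L \<longleftrightarrow> ?R")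
proof
  assume L: ?L
  then have "transitive_action (Perm G\<lparr>carrier := N\<rparr>) (carrier G) (\<lambda>\<nu>. \<nu>)"
    by (simp add: regular_subgroup_def)
  from transitive_action.unique_orbit[OF this] L show ?R
    by (auto simp: regular_subgroup_def stabilizer_def)
next
  assume R: ?R
  then have N: "subgroup N (Perm G)" by simp
  have "group_hom (Perm G\<lparr>carrier := N\<rparr>) (BijGroup (carrier G)) (\<lambda>\<nu>. \<nu>)"
    unfolding group_hom_def group_hom_axioms_def
    using Perm.subgroup_imp_group[OF N] subgroup.subset[OF N] group_BijGroup
    by (auto simp: hom_def Perm_def)
  then have "transitive_action (Perm G\<lparr>carrier := N\<rparr>) (carrier G) (\<lambda>\<nu>. \<nu>)"
    using R by (simp add: transitive_action_def group_action_def transitive_action_axioms_def)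
  moreover have "stabilizer (Perm G\<lparr>carrier := N\<rparr>) (\<lambda>\<nu>. \<nu>) x = {\<one>\<^bsub>Perm G\<^esub>}"
    if "x \<in> carrier G" for x
    using R that subgroup.one_closed[OF N] by (auto simp: stabilizer_def Perm_one_apply)
  ultimately show ?L
    using N by (simp add: regular_subgroup_def)
qed

lemma G_isomorphic_trans:
  assumes "G_isomorphic G N M" "G_isomorphic G M L"
  shows "G_isomorphic G N L"
proof -
  obtain \<theta> where \<theta>: "\<theta> \<in> iso (Perm G\<lparr>carrier := N\<rparr>) (Perm G\<lparr>carrier := M\<rparr>)"
    "\<forall>\<nu>\<in>N. \<forall>x\<in>carrier G. \<theta> (G_act G x \<nu>) = G_act G x (\<theta> \<nu>)"
    using assms(1) unfolding G_isomorphic_def by blast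
  obtain \<phi> where \<phi>: "\<phi> \<in> iso (Perm G\<lparr>carrier := M\<rparr>) (Perm G\<lparr>carrier := L\<rparr>)"
    "\<forall>\<nu>\<in>M. \<forall>x\<in>carrier G. \<phi> (G_act G x \<nu>) = G_act G x (\<phi> \<nu>)"
    using assms(2) unfolding G_isomorphic_def by blast
  have "\<theta> \<nu> \<in> M" if "\<nu> \<in> N" for \<nu>
    using \<theta>(1) that by (auto simp: iso_def hom_def)
  then have "\<forall>\<nu>\<in>N. \<forall>x\<in>carrier G. (\<phi> \<circ> \<theta>) (G_act G x \<nu>) = G_act G x ((\<phi> \<circ> \<theta>) \<nu>)"
    using \<theta>(2) \<phi>(2) by simp
  then show ?thesis
    using assms iso_set_trans[OF \<theta>(1) \<phi>(1)] unfolding G_isomorphic_def by blast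
qed

lemma G_isomorphic_sym:
  assumes "G_isomorphic G N M"
  shows "G_isomorphic G M N"
proof -
  obtain \<theta> where \<theta>: "\<theta> \<in> iso (Perm G\<lparr>carrier := N\<rparr>) (Perm G\<lparr>carrier := M\<rparr>)"
    "\<forall>\<nu>\<in>N. \<forall>x\<in>carrier G. \<theta> (G_act G x \<nu>) = G_act G x (\<theta> \<nu>)"
    using assms unfolding G_isomorphic_def by blast
  have N: "subgroup N (Perm G)" "G_stable G N"
    using assms by (auto simp: G_isomorphic_def regular_subgroup_def)
  have bij: "bij_betw \<theta> N M"
    using \<theta>(1) by (simp add: iso_def)
  have inv_iso: "inv_into N \<theta> \<in> iso (Perm G\<lparr>carrier := M\<rparr>) (Perm G\<lparr>carrier := N\<rparr>)"
    using group.iso_set_sym[OF Perm.subgroup_imp_group[OF N(1)] \<theta>(1)] by simp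
  have "inv_into N \<theta> (G_act G x \<nu>) = G_act G x (inv_into N \<theta> \<nu>)"
    if \<nu>: "\<nu> \<in> M" and x: "x \<in> carrier G" for \<nu> x
  proof -
    obtain \<mu> where \<mu>: "\<mu> \<in> N" "\<theta> \<mu> = \<nu>"
      using bij \<nu> by (auto simp: bij_betw_def)
    then have "G_act G x \<mu> \<in> N"
      using N(2) x by (auto simp: G_stable_def)
    moreover have "G_act G x \<nu> = \<theta> (G_act G x \<mu>)"
      using \<theta>(2) \<mu> x by simp
    ultimately show ?thesis
      using bij \<mu> by (auto simp: bij_betw_def)
  qed
  then show ?thesis
    using assms inv_iso unfolding G_isomorphic_def by blast
qed

text \<open>Since \<open>\<kappa>\<close> commutes with every \<open>\<lambda>(x)\<close>, conjugation by \<open>\<kappa>\<close> is itself a \<open>G\<close>-isomorphism.\<close>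

lemma G_isomorphic_conj_centralising:
  assumes N: "regular_subgroup G N" "G_stable G N" and \<kappa>: "\<kappa> \<in> carrier (Perm G)"
    and comm: "\<And>x y. x \<in> carrier G \<Longrightarrow> y \<in> carrier G \<Longrightarrow> \<kappa> (x \<otimes> y) = x \<otimes> \<kappa> y"
  shows "G_isomorphic G N ((\<lambda>\<nu>. inv\<^bsub>Perm G\<^esub> \<kappa> \<otimes>\<^bsub>Perm G\<^esub> \<nu> \<otimes>\<^bsub>Perm G\<^esub> \<kappa>) ` N)"
proof -
  define c where "c \<nu> = inv\<^bsub>Perm G\<^esub> \<kappa> \<otimes>\<^bsub>Perm G\<^esub> \<nu> \<otimes>\<^bsub>Perm G\<^esub> \<kappa>" for \<nu>
  have subN: "subgroup N (Perm G)"
    and trans: "\<And>x y. x \<in> carrier G \<Longrightarrow> y \<in> carrier G \<Longrightarrow> \<exists>\<nu>\<in>N. \<nu> x = y"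
    and free: "\<And>\<nu> x. \<nu> \<in> N \<Longrightarrow> x \<in> carrier G \<Longrightarrow> \<nu> x = x \<Longrightarrow> \<nu> = \<one>\<^bsub>Perm G\<^esub>"
    using N(1) by (auto simp: regular_subgroup_iff)
  have NP: "\<nu> \<in> carrier (Perm G)" if "\<nu> \<in> N" for \<nu>
    using subgroup.subset[OF subN] that by blast
  have c_apply: "\<kappa> (c \<nu> x) = \<nu> (\<kappa> x)" if "\<nu> \<in> carrier (Perm G)" "x \<in> carrier G" for \<nu> x
  proof -
    have "\<kappa> \<otimes>\<^bsub>Perm G\<^esub> c \<nu> = \<nu> \<otimes>\<^bsub>Perm G\<^esub> \<kappa>"
      using that \<kappa> by (simp add: c_def Perm.m_assoc[symmetric])
    moreover have "c \<nu> \<in> carrier (Perm G)"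
      using that \<kappa> by (simp add: c_def)
    ultimately show ?thesis
      using that \<kappa> Perm_mult_apply by metis
  qed
  have c_hom: "c \<in> hom (Perm G) (Perm G)"
    using Perm.conjugation_hom[of "inv\<^bsub>Perm G\<^esub> \<kappa>"] \<kappa> by (simp add: c_def[abs_def])
  then interpret c: group_hom "Perm G" "Perm G" c
    by unfold_locales
  have inj: "inj_on c (carrier (Perm G))"
    using \<kappa> by (auto intro!: inj_onI simp: c_def)
  have stab: "c (G_act G x \<nu>) = G_act G x (c \<nu>)" if "\<nu> \<in> N" "x \<in> carrier G" for x \<nu>
  proof -
    have eq: "\<kappa> \<otimes>\<^bsub>Perm G\<^esub> left_transl G x = left_transl G x \<otimes>\<^bsub>Perm G\<^esub> \<kappa>"
      by (rule Perm_eqI)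
        (use \<kappa> that comm left_transl_in_Perm Perm_closed[OF \<kappa>] in
          \<open>simp_all add: Perm_mult_apply, simp_all add: left_transl_def\<close>)
    have l: "left_transl G x \<in> carrier (Perm G)"
      using that by (simp add: left_transl_in_Perm)
    have "c (left_transl G x) = left_transl G x"
      using l \<kappa> by (simp add: c_def Perm.m_assoc eq[symmetric]) (simp add: Perm.m_assoc[symmetric])
    then show ?thesis
      using l NP[OF that(1)] by (simp add: G_act_def)
  qed
  have "subgroup (c ` N) (Perm G)"
    using c.subgroup_img_is_subgroup[OF subN] .
  moreover have "\<exists>\<mu>\<in>c ` N. \<mu> x = y" if xy: "x \<in> carrier G" "y \<in> carrier G" for x y
  proof -
    obtain \<nu> where \<nu>: "\<nu> \<in> N" "\<nu> (\<kappa> x) = \<kappa> y"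
      using trans Perm_closed[OF \<kappa>] xy by meson
    then have "\<kappa> (c \<nu> x) = \<kappa> y"
      using c_apply NP xy by simp
    then have "c \<nu> x = y"
      using Perm_inv_apply[OF \<kappa>] Perm_closed[OF c.hom_closed[OF NP[OF \<nu>(1)]]] xy by metis
    then show ?thesis using \<nu> by blast
  qed
  moreover have "\<mu> = \<one>\<^bsub>Perm G\<^esub>" if \<mu>: "\<mu> \<in> c ` N" "x \<in> carrier G" "\<mu> x = x" for \<mu> x
  proof -
    obtain \<nu> where \<nu>: "\<nu> \<in> N" "\<mu> = c \<nu>" using \<mu> by blast
    then have "\<nu> (\<kappa> x) = \<kappa> x"
      using c_apply[OF NP[OF \<nu>(1)] \<mu>(2)] \<mu> by simp
    then show ?thesis
      using free[OF \<nu>(1) Perm_closed[OF \<kappa> \<mu>(2)]] \<nu> by simp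
  qed
  ultimately have "regular_subgroup G (c ` N)"
    by (simp add: regular_subgroup_iff)
  moreover have "G_stable G (c ` N)"
    using N(2) stab by (auto simp: G_stable_def simp flip: stab)
  moreover have "c \<in> iso (Perm G\<lparr>carrier := N\<rparr>) (Perm G\<lparr>carrier := c ` N\<rparr>)"
    using inj_on_subset[OF inj] NP c.hom_mult by (auto simp: iso_def hom_def bij_betw_def)
  ultimately have "G_isomorphic G N (c ` N)"
    using N stab unfolding G_isomorphic_def by blast
  then show ?thesis by (simp add: c_def)
qed

text \<open>An inner automorphism is \<open>\<lambda>(z) \<kappa>\<close> with \<open>\<kappa>\<close> the right translation by \<open>z\<^sup>-\<^sup>1\<close>. Conjugation by
  \<open>\<lambda>(z)\<close> preserves the \<open>G\<close>-stable subgroup \<open>N\<close>, and \<open>\<kappa>\<close> commutes with left translations.\<close>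

lemma G_isomorphic_conj_inner:
  assumes N: "regular_subgroup G N" "G_stable G N" and \<phi>: "\<phi> \<in> carrier (Perm G)"
    and z: "z \<in> carrier G" and inner: "\<And>x. x \<in> carrier G \<Longrightarrow> \<phi> x = z \<otimes> x \<otimes> inv z"
  shows "G_isomorphic G N ((\<lambda>\<nu>. inv\<^bsub>Perm G\<^esub> \<phi> \<otimes>\<^bsub>Perm G\<^esub> \<nu> \<otimes>\<^bsub>Perm G\<^esub> \<phi>) ` N)"
proof -
  define l where "l = left_transl G z"
  define \<kappa> where "\<kappa> = inv\<^bsub>Perm G\<^esub> l \<otimes>\<^bsub>Perm G\<^esub> \<phi>"
  have l: "l \<in> carrier (Perm G)"
    using z by (simp add: l_def left_transl_in_Perm)
  have \<kappa>: "\<kappa> \<in> carrier (Perm G)"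
    using l \<phi> by (simp add: \<kappa>_def)
  have \<phi>_eq: "\<phi> = l \<otimes>\<^bsub>Perm G\<^esub> \<kappa>"
    using l \<phi> by (simp add: \<kappa>_def Perm.m_assoc[symmetric])
  have \<kappa>_apply: "\<kappa> x = x \<otimes> inv z" if x: "x \<in> carrier G" for x
  proof -
    have "l (\<kappa> x) = \<phi> x"
      using Perm_mult_apply[OF l \<kappa> x] \<phi>_eq by simp
    then have "z \<otimes> \<kappa> x = z \<otimes> (x \<otimes> inv z)"
      using inner[OF x] Perm_closed[OF \<kappa> x] x z by (simp add: l_def left_transl_def m_assoc)
    then show ?thesis
      using Perm_closed[OF \<kappa> x] x z by simp
  qed
  \<comment> \<open>\<open>N\<close> is stable under conjugation by \<open>\<lambda>(z)\<close> and by its inverse \<open>\<lambda>(z\<^sup>-\<^sup>1)\<close>.\<close>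
  have "(\<lambda>\<nu>. inv\<^bsub>Perm G\<^esub> l \<otimes>\<^bsub>Perm G\<^esub> \<nu> \<otimes>\<^bsub>Perm G\<^esub> l) ` N = N" (is "?c ` N = N")
  proof -
    have NP: "\<nu> \<in> carrier (Perm G)" if "\<nu> \<in> N" for \<nu>
      using N(1) subgroup.subset that by (auto simp: regular_subgroup_def)
    have "left_transl G (inv z) \<otimes>\<^bsub>Perm G\<^esub> l = \<one>\<^bsub>Perm G\<^esub>"
      by (rule Perm_eqI)
        (use z l left_transl_in_Perm in
          \<open>simp_all add: Perm_mult_apply Perm_one_apply, simp_all add: l_def left_transl_def m_assoc[symmetric]\<close>)
    then have inv_l: "inv\<^bsub>Perm G\<^esub> l = left_transl G (inv z)"
      using Perm.inv_equality l z left_transl_in_Perm by simp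
    have "?c \<nu> \<in> N" if "\<nu> \<in> N" for \<nu>
    proof -
      have "?c \<nu> = G_act G (inv z) \<nu>"
        using l by (simp add: G_act_def inv_l[symmetric])
      then show ?thesis using N(2) z that by (simp add: G_stable_def)
    qed
    moreover have "\<exists>\<mu>\<in>N. \<nu> = ?c \<mu>" if "\<nu> \<in> N" for \<nu>
    proof
      show "G_act G z \<nu> \<in> N" using N(2) z that by (simp add: G_stable_def)
      show "\<nu> = ?c (G_act G z \<nu>)"
        using l NP[OF that] by (simp add: G_act_def l_def[symmetric] Perm.m_assoc)
          (simp add: Perm.m_assoc[symmetric])
    qed
    ultimately show ?thesis by blast
  qed
  moreover have "(\<lambda>\<nu>. inv\<^bsub>Perm G\<^esub> \<phi> \<otimes>\<^bsub>Perm G\<^esub> \<nu> \<otimes>\<^bsub>Perm G\<^esub> \<phi>) ` N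
      = (\<lambda>\<nu>. inv\<^bsub>Perm G\<^esub> \<kappa> \<otimes>\<^bsub>Perm G\<^esub> \<nu> \<otimes>\<^bsub>Perm G\<^esub> \<kappa>) ` ?c ` N"
    unfolding image_image
    using N(1) subgroup.subset l \<kappa>
    by (intro image_cong)
       (auto simp: \<phi>_eq Perm.inv_mult_group Perm.m_assoc regular_subgroup_def subset_iff dest!: subgroup.subset)
  ultimately show ?thesis
    using G_isomorphic_conj_centralising[OF N \<kappa>] \<kappa>_apply z by (simp add: m_assoc)
qed

lemma G_isomorphic_conj_pow:
  assumes "regular_subgroup G N" "G_stable G N" and \<psi>: "\<psi> \<in> carrier (Perm G)"
    and z: "z \<in> carrier G" and inner: "\<And>x. x \<in> carrier G \<Longrightarrow> \<psi> x = z \<otimes> x \<otimes> inv z"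
  shows "G_isomorphic G N (conj_pow G \<psi> u N)"
proof -
  have "(\<psi> [^]\<^bsub>Perm G\<^esub> u) x = z [^] u \<otimes> x \<otimes> inv (z [^] u)" if "x \<in> carrier G" for x
    using that
  proof (induction u arbitrary: x)
    case 0
    then show ?case by (simp add: Perm_one_apply)
  next
    case (Suc u)
    then show ?case
      using z \<psi> by (simp add: Perm_mult_apply inner m_assoc inv_mult_group)
  qed
  then show ?thesis
    using G_isomorphic_conj_inner[OF assms(1,2), of "\<psi> [^]\<^bsub>Perm G\<^esub> u" "z [^] u"] \<psi> z
    by (simp add: conj_pow_def int_pow_int Perm.int_pow_neg_int)
qed

end

section \<open>Coordinates on the group of order \<open>pq\<close>\<close>

text \<open>An integer and its least natural residue have the same powers modulo \<open>n\<close>; this carries facts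
  on the order of a natural number over to integers.\<close>

lemma order_int_eq_order_residue:
  "Pocklington.ord (int n) (a :: int) = Pocklington.ord n (nat (a mod int n))" if "n > 0"
proof -
  have eq: "[a = int (nat (a mod int n))] (mod int n)"
    using that by (simp add: cong_def)
  have "coprime (int n) a \<longleftrightarrow> coprime (int n) (int (nat (a mod int n)))"
    using cong_imp_coprime[OF eq] cong_imp_coprime[OF cong_sym[OF eq]] by (auto simp: coprime_commute)
  moreover have "[a ^ d = 1] (mod int n) \<longleftrightarrow> [nat (a mod int n) ^ d = 1] (mod n)" for d
  proof -
    have "[a ^ d = 1] (mod int n) \<longleftrightarrow> [int (nat (a mod int n)) ^ d = 1] (mod int n)"
      using cong_pow[OF eq, of d] cong_trans cong_sym by blast
    also have "\<dots> \<longleftrightarrow> [nat (a mod int n) ^ d = 1] (mod n)"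
      by (metis cong_int_iff of_nat_1 of_nat_power)
    finally show ?thesis .
  qed
  ultimately show ?thesis
    unfolding Pocklington.ord_def coprime_int_iff by simp
qed

lemma int_power_cong_iff:
  assumes "Pocklington.ord (int n) g = m" "m > 0" "n > 0"
  shows "[g ^ d = g ^ e] (mod int n) \<longleftrightarrow> [d = e] (mod m)"
proof -
  define h where "h = nat (g mod int n)"
  have eq: "[g = int h] (mod int n)"
    using assms by (simp add: cong_def h_def)
  have ord_h: "Pocklington.ord n h = m"
    using assms order_int_eq_order_residue[of n g] by (simp add: h_def)
  then have "coprime n h"
    using assms ord_eq_0[of n h] by auto
  from order_divides_expdiff[OF this, of d e] ord_h
  have "[h ^ d = h ^ e] (mod n) \<longleftrightarrow> [d = e] (mod m)"
    by simp
  moreover have "[g ^ d = g ^ e] (mod int n) \<longleftrightarrow> [int h ^ d = int h ^ e] (mod int n)"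
    using cong_pow[OF eq, of d] cong_pow[OF eq, of e] cong_trans cong_sym by meson
  ultimately show ?thesis
    by (metis cong_int_iff of_nat_power)
qed

locale order_pq_group = group +
  fixes p q :: nat and g :: int and \<sigma> \<tau> :: 'a
  assumes prime_p: "prime p" and prime_q: "prime q" and q_less_p: "q < p"
    and order_g: "Pocklington.ord (int p) g = q"
    and order_G: "order G = p * q"
    and \<sigma>_closed [simp]: "\<sigma> \<in> carrier G" and \<tau>_closed [simp]: "\<tau> \<in> carrier G"
    and order_\<sigma>: "ord \<sigma> = p" and order_\<tau>: "ord \<tau> = q"
    and \<tau>_\<sigma>: "\<tau> \<otimes> \<sigma> \<otimes> inv \<tau> = \<sigma> [^] g"
    and normal_forms: "carrier G = {\<sigma> [^] i \<otimes> \<tau> [^] j | i j :: nat. i \<le> p - 1 \<and> j \<le> q - 1}"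
begin

definition pt :: "int \<Rightarrow> nat \<Rightarrow> 'a" where "pt k l = \<sigma> [^] k \<otimes> \<tau> [^] l"

lemma p_pos: "p > 0" and q_pos: "q > 0"
  using prime_p prime_q prime_gt_0_nat by auto

lemma g_power_cong: "[g ^ d = g ^ e] (mod int p) \<longleftrightarrow> [d = e] (mod q)"
  by (rule int_power_cong_iff[OF order_g q_pos p_pos])

lemma ex_additive_inverse: "\<exists>b'. [b + b' = 0] (mod q)"
proof
  have "b + (q - 1) * b = q * b"
    using q_pos by (cases q) auto
  then show "[b + (q - 1) * b = 0] (mod q)"
    by (simp add: cong_0_iff)
qed

lemma g_power_inverse:
  assumes "[b + b' = 0] (mod q)"
  shows "[g ^ (r * b) * g ^ (r * b') = 1] (mod int p)"
proof -
  have "[r * b + r * b' = 0] (mod q)"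
    using cong_scalar_left[OF assms, of r] by (simp add: algebra_simps)
  then have "[g ^ (r * b + r * b') = g ^ 0] (mod int p)"
    by (simp only: g_power_cong)
  then show ?thesis by (simp add: power_add)
qed

lemma g_power_nonzero: "\<not> [g ^ d = 0] (mod int p)"
proof
  assume "[g ^ d = 0] (mod int p)"
  then have "int p dvd g"
    using prime_p by (metis cong_0_iff prime_dvd_power prime_nat_int_transfer)
  then have "\<not> coprime (int p) g"
    using prime_p not_prime_unit by auto
  then show False
    using order_g q_pos by (simp add: Pocklington.ord_def)
qed

lemma pt_closed [simp]: "pt k l \<in> carrier G"
  by (simp add: pt_def)

text \<open>There are \<open>pq\<close> normal forms for the \<open>pq\<close> elements of \<open>G\<close>, so no two of them coincide.\<close>

lemma normal_form_inj:
  "inj_on (\<lambda>(i, j). \<sigma> [^] (i::nat) \<otimes> \<tau> [^] (j::nat)) ({..<p} \<times> {..<q})"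
proof -
  have "i \<le> p - 1 \<longleftrightarrow> i < p" "i \<le> q - 1 \<longleftrightarrow> i < q" for i
    using p_pos q_pos by linarith+
  then have "(\<lambda>(i, j). \<sigma> [^] (i::nat) \<otimes> \<tau> [^] (j::nat)) ` ({..<p} \<times> {..<q}) = carrier G"
    unfolding normal_forms by (auto simp: image_iff)
  then have "card ((\<lambda>(i, j). \<sigma> [^] (i::nat) \<otimes> \<tau> [^] (j::nat)) ` ({..<p} \<times> {..<q}))
      = card ({..<p} \<times> {..<q})"
    using order_G by (simp add: order_def)
  then show ?thesis
    by (intro eq_card_imp_inj_on) auto
qed

lemma pt_reduce: "pt k l = \<sigma> [^] nat (k mod int p) \<otimes> \<tau> [^] (l mod q)"
proof -
  have "\<sigma> [^] k = \<sigma> [^] (k mod int p)"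
    using int_pow_eq[of \<sigma> "k" "k mod int p"] order_\<sigma> by (simp add: mod_eq_dvd_iff[symmetric])
  also have "\<dots> = \<sigma> [^] nat (k mod int p)"
    using p_pos by (simp flip: int_pow_int)
  finally have "\<sigma> [^] k = \<sigma> [^] nat (k mod int p)" .
  moreover have "\<tau> [^] l = \<tau> [^] (l mod q)"
    using pow_ord_eq_1[OF \<tau>_closed] order_\<tau> nat_pow_mult[OF \<tau>_closed, of "q * (l div q)" "l mod q"]
      nat_pow_pow[OF \<tau>_closed, of q "l div q"] by (simp add: eq_commute[of "\<one>"])
  ultimately show ?thesis
    by (simp add: pt_def)
qed

lemma pt_eq_iff: "pt k l = pt k' l' \<longleftrightarrow> [k = k'] (mod int p) \<and> [l = l'] (mod q)"
proof
  assume "pt k l = pt k' l'"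
  then have "(nat (k mod int p), l mod q) = (nat (k' mod int p), l' mod q)"
    unfolding pt_reduce[of k] pt_reduce[of k']
    using p_pos q_pos by (intro inj_onD[OF normal_form_inj]) (auto simp: nat_less_iff)
  then show "[k = k'] (mod int p) \<and> [l = l'] (mod q)"
    using p_pos by (simp add: cong_def nat_eq_iff)
qed (simp add: pt_reduce cong_def)

lemma carrier_pt:
  assumes "x \<in> carrier G"
  obtains k l where "x = pt (int k) l"
  using assms unfolding normal_forms by (auto simp: pt_def int_pow_int)

lemma \<tau>_power_\<sigma>_power: "\<tau> [^] l \<otimes> \<sigma> [^] (k::int) = \<sigma> [^] (g ^ l * k) \<otimes> \<tau> [^] (l::nat)"
proof (induction l arbitrary: k)
  case (Suc l)
  have "(\<lambda>x. \<tau> \<otimes> x \<otimes> inv \<tau>) (\<sigma> [^] k) = (\<sigma> [^] g) [^] k"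
    using hom_int_pow[OF conjugation_hom[OF \<tau>_closed] \<sigma>_closed is_group is_group, of k] \<tau>_\<sigma> by simp
  then have "\<tau> \<otimes> \<sigma> [^] k \<otimes> inv \<tau> = \<sigma> [^] (g * k)"
    by (simp add: int_pow_pow)
  then have step: "\<tau> \<otimes> \<sigma> [^] k = \<sigma> [^] (g * k) \<otimes> \<tau>"
    by (metis \<sigma>_closed \<tau>_closed int_pow_closed inv_solve_right' m_closed)
  have "\<tau> [^] Suc l \<otimes> \<sigma> [^] k = \<tau> [^] l \<otimes> \<sigma> [^] (g * k) \<otimes> \<tau>"
    by (simp add: m_assoc step)
  also have "\<dots> = \<sigma> [^] (g ^ l * (g * k)) \<otimes> \<tau> [^] l \<otimes> \<tau>"
    by (simp add: Suc)
  finally show ?case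
    by (simp add: m_assoc ac_simps)
qed simp

lemma pt_mult: "pt k l \<otimes> pt k' l' = pt (k + g ^ l * k') (l + l')"
proof -
  have "pt k l \<otimes> pt k' l' = \<sigma> [^] k \<otimes> (\<tau> [^] l \<otimes> \<sigma> [^] k') \<otimes> \<tau> [^] l'"
    by (simp add: pt_def m_assoc)
  also have "\<dots> = (\<sigma> [^] k \<otimes> \<sigma> [^] (g ^ l * k')) \<otimes> (\<tau> [^] l \<otimes> \<tau> [^] l')"
    by (simp add: \<tau>_power_\<sigma>_power m_assoc)
  finally show ?thesis
    by (simp add: pt_def int_pow_mult nat_pow_mult)
qed

section \<open>The subgroups in coordinates\<close>

text \<open>The two families are treated together: \<open>N\<^sub>t\<close> is the case \<open>r = 0\<close>, \<open>s = t\<close>, and \<open>N\<^sub>t\<^sup>o\<^sup>p\<^sup>p\<close> the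
  case \<open>r = t\<close>, \<open>s = 0\<close>. For any fixed \<open>r\<close> and \<open>s\<close> these maps form a regular group; its stability
  under \<open>G\<close> is proved below in the two cases.\<close>

definition affine :: "nat \<Rightarrow> nat \<Rightarrow> int \<Rightarrow> nat \<Rightarrow> 'a \<Rightarrow> 'a" where
  "affine r s a b =
    on_normal_form G \<sigma> \<tau> (\<lambda>k l. pt (g ^ (s * b) * int k + a * g ^ (r * l)) (l + b))"

lemma affine_pt [simp]: "affine r s a b (pt k l) = pt (g ^ (s * b) * k + a * g ^ (r * l)) (l + b)"
proof -
  have resp: "pt (g ^ (s * b) * k + a * g ^ (r * l)) (l + b)
      = pt (g ^ (s * b) * k' + a * g ^ (r * l')) (l' + b)"
    if "pt k l = pt k' l'" for k l k' l'
  proof -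
    have "[k = k'] (mod int p)" "[g ^ (r * l) = g ^ (r * l')] (mod int p)" "[l = l'] (mod q)"
      using that by (auto simp: pt_eq_iff g_power_cong cong_scalar_left)
    then show ?thesis
      by (auto simp: pt_eq_iff cong_scalar_left cong_add cong_add_rcancel_nat)
  qed
  obtain k' l' where k': "pt k l = pt (int k') l'"
    using carrier_pt[OF pt_closed] by metis
  have "affine r s a b (\<sigma> [^] k' \<otimes> \<tau> [^] l') = pt (g ^ (s * b) * int k' + a * g ^ (r * l')) (l' + b)"
    unfolding affine_def
    by (rule on_normal_form_eq[OF is_group \<sigma>_closed \<tau>_closed], rule resp)
       (simp add: pt_def int_pow_int)
  then show ?thesis
    unfolding resp[OF k'] unfolding k' by (simp add: pt_def int_pow_int)
qed

lemma affine_extensional: "affine r s a b \<in> extensional (carrier G)"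
  by (simp add: affine_def on_normal_form_def)

lemma affine_in_Perm: "affine r s a b \<in> carrier (Perm G)"
proof -
  have surj: "affine r s a b ` carrier G = carrier G"
  proof (intro equalityI subsetI)
    fix y assume "y \<in> carrier G"
    then obtain k l where y: "y = pt (int k) l" by (rule carrier_pt)
    obtain b' where b': "[b + b' = 0] (mod q)"
      using ex_additive_inverse by blast
    have "[g ^ (s * b) * (g ^ (s * b') * K) = K] (mod int p)" for K
      using cong_scalar_right[OF g_power_inverse[OF b', of s], of K] by (simp add: mult.assoc)
    from cong_add[OF this cong_refl, of "int k - a * g ^ (r * (l + b'))" "a * g ^ (r * (l + b'))"]
    have "affine r s a b (pt (g ^ (s * b') * (int k - a * g ^ (r * (l + b')))) (l + b')) = y"
      using cong_add_lcancel_nat[of l "b + b'" 0 q] b' unfolding y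
      by (simp add: pt_eq_iff ac_simps)
    then show "y \<in> affine r s a b ` carrier G"
      by (metis imageI pt_closed)
  next
    fix y assume "y \<in> affine r s a b ` carrier G"
    then obtain x where "x \<in> carrier G" "y = affine r s a b x" by blast
    then show "y \<in> carrier G"
      using carrier_pt[of x] affine_pt pt_closed by metis
  qed
  have "finite (carrier G)"
    using order_G p_pos q_pos by (auto simp: order_def intro: card_ge_0_finite)
  then have "bij_betw (affine r s a b) (carrier G) (carrier G)"
    using surj by (simp add: bij_betw_def finite_surj_inj)
  then show ?thesis
    by (simp add: Perm_def BijGroup_def Bij_def affine_extensional)
qed

lemma affine_eqI:
  assumes "\<nu> \<in> carrier (Perm G)"
    and "\<And>k l. \<nu> (pt (int k) l) = pt (g ^ (s * b) * int k + a * g ^ (r * l)) (l + b)"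
  shows "\<nu> = affine r s a b"
proof (rule Perm_eqI[OF assms(1) affine_in_Perm])
  fix x assume "x \<in> carrier G"
  then obtain k l where "x = pt (int k) l" by (rule carrier_pt)
  then show "\<nu> x = affine r s a b x" by (simp add: assms(2))
qed

lemma affine_eq_iff: "affine r s a b = affine r s a' b' \<longleftrightarrow> [a = a'] (mod int p) \<and> [b = b'] (mod q)"
proof
  assume "affine r s a b = affine r s a' b'"
  then have "affine r s a b (pt 0 0) = affine r s a' b' (pt 0 0)"
    by simp
  then show "[a = a'] (mod int p) \<and> [b = b'] (mod q)"
    by (simp add: pt_eq_iff)
next
  assume eq: "[a = a'] (mod int p) \<and> [b = b'] (mod q)"
  then have "[g ^ (s * b) = g ^ (s * b')] (mod int p)"
    by (simp add: g_power_cong cong_scalar_left)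
  then have "[g ^ (s * b') * k + a' * g ^ (r * l) = g ^ (s * b) * k + a * g ^ (r * l)] (mod int p)"
    for k l
    using eq by (intro cong_add cong_scalar_right) (auto intro: cong_sym)
  moreover have "[l + b' = l + b] (mod q)" for l
    using eq cong_sym by (auto simp: cong_add_lcancel_nat)
  ultimately have "affine r s a' b' = affine r s a b"
    by (intro affine_eqI affine_in_Perm) (simp add: pt_eq_iff)
  then show "affine r s a b = affine r s a' b'" ..
qed

lemma affine_mult:
  "affine r s a b \<otimes>\<^bsub>Perm G\<^esub> affine r s a' b' = affine r s (g ^ (s * b) * a' + a * g ^ (r * b')) (b + b')"
  by (rule affine_eqI)
    (auto simp: Perm_mult_apply affine_in_Perm group.is_monoid[OF group_Perm] monoid.m_closed
      algebra_simps power_add)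

lemma affine_one: "\<one>\<^bsub>Perm G\<^esub> = affine r s 0 0"
  by (rule affine_eqI) (auto simp: Perm_one_apply group.is_monoid[OF group_Perm] monoid.one_closed)

definition affine_group :: "nat \<Rightarrow> nat \<Rightarrow> ('a \<Rightarrow> 'a) set" where
  "affine_group r s = {affine r s a b | a b. True}"

lemma affine_mem [simp]: "affine r s a b \<in> affine_group r s"
  by (auto simp: affine_group_def)

lemma affine_groupE:
  assumes "\<nu> \<in> affine_group r s"
  obtains a b where "\<nu> = affine r s a b"
  using assms by (auto simp: affine_group_def)

lemma subgroup_affine_group: "subgroup (affine_group r s) (Perm G)"
proof (rule group.subgroupI[OF group_Perm])
  fix \<nu> assume "\<nu> \<in> affine_group r s"
  then obtain a b where \<nu>: "\<nu> = affine r s a b" by (auto simp: affine_group_def)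
  obtain b' where b': "[b + b' = 0] (mod q)"
    using ex_additive_inverse by blast
  have "[g ^ (s * b') * a - g ^ (s * b') * a * (g ^ (r * b) * g ^ (r * b')) = 0] (mod int p)"
    using cong_scalar_left[OF g_power_inverse[OF b', of r], of "g ^ (s * b') * a"]
    by (simp add: cong_iff_dvd_diff dvd_diff_commute)
  then have "affine r s (- (g ^ (s * b') * a * g ^ (r * b'))) b' \<otimes>\<^bsub>Perm G\<^esub> \<nu> = \<one>\<^bsub>Perm G\<^esub>"
    using b' by (simp add: \<nu> affine_mult affine_one[of r s] affine_eq_iff power_add ac_simps)
  then show "inv\<^bsub>Perm G\<^esub> \<nu> \<in> affine_group r s"
    using group.inv_equality[OF group_Perm] affine_in_Perm \<nu> affine_mem by metis
qed (auto elim!: affine_groupE simp: affine_in_Perm affine_mult intro: affine_mem)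

text \<open>The product of \<open>(a, 0)\<close> and \<open>(0, b)\<close> is \<open>(a g\<^sup>r\<^sup>b, b)\<close>, and \<open>g\<^sup>r\<^sup>b\<close> is invertible modulo \<open>p\<close>, so
  every pair arises in this way from powers of the two generators.\<close>

lemma generate_affine_group:
  "generate (Perm G) {affine r s 1 0, affine r s 0 1} = affine_group r s" (is "?H = _")
proof
  show "?H \<subseteq> affine_group r s"
    by (rule group.generate_subgroup_incl[OF group_Perm _ subgroup_affine_group]) auto
next
  have mult: "\<mu> \<otimes>\<^bsub>Perm G\<^esub> \<nu> \<in> ?H" if "\<mu> \<in> ?H" "\<nu> \<in> ?H" for \<mu> \<nu>
    using that by (rule generate.eng)
  have one: "affine r s 0 0 \<in> ?H"
    using generate.one[of "Perm G"] by (simp add: affine_one[of r s])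
  have a: "affine r s (int n) 0 \<in> ?H" for n
  proof (induction n)
    case (Suc n)
    have "affine r s 1 0 \<otimes>\<^bsub>Perm G\<^esub> affine r s (int n) 0 \<in> ?H"
      by (rule mult[OF _ Suc]) (simp add: generate.incl)
    then show ?case by (simp add: affine_mult add.commute)
  qed (use one in simp)
  have b: "affine r s 0 n \<in> ?H" for n
  proof (induction n)
    case (Suc n)
    have "affine r s 0 1 \<otimes>\<^bsub>Perm G\<^esub> affine r s 0 n \<in> ?H"
      by (rule mult[OF _ Suc]) (simp add: generate.incl)
    then show ?case by (simp add: affine_mult)
  qed (use one in simp)
  show "affine_group r s \<subseteq> ?H"
  proof
    fix \<nu> assume "\<nu> \<in> affine_group r s"
    then obtain a b where \<nu>: "\<nu> = affine r s a b" by (auto simp: affine_group_def)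
    obtain b' where b': "[b + b' = 0] (mod q)"
      using ex_additive_inverse by blast
    define n where "n = nat (a * g ^ (r * b') mod int p)"
    have "[int n * g ^ (r * b) = a * g ^ (r * b') * g ^ (r * b)] (mod int p)"
      using p_pos by (intro cong_scalar_right) (simp add: n_def cong_def)
    also have "[a * g ^ (r * b') * g ^ (r * b) = a * 1] (mod int p)"
      using cong_scalar_left[OF g_power_inverse[OF b', of r], of a] by (simp add: ac_simps)
    finally have "\<nu> = affine r s (int n) 0 \<otimes>\<^bsub>Perm G\<^esub> affine r s 0 b"
      by (simp add: \<nu> affine_mult affine_eq_iff cong_sym)
    then show "\<nu> \<in> ?H" using mult a b by simp
  qed
qed

lemma sub_N_eq: "sub_N G \<sigma> \<tau> g t = affine_group 0 t"
proof -
  have "perm_eta G \<sigma> \<tau> = affine 0 t 1 0"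
    by (simp add: perm_eta_def affine_def pt_def add.commute flip: int_pow_int)
  moreover have "perm_pi_t G \<sigma> \<tau> g t = affine 0 t 0 1"
    by (simp add: perm_pi_t_def affine_def pt_def mult.commute)
  ultimately show ?thesis
    by (simp add: sub_N_def generate_affine_group del: One_nat_def)
qed

lemma sub_Nopp_eq: "sub_Nopp G \<sigma> \<tau> g t = affine_group t 0"
proof -
  have "perm_eta_t G \<sigma> \<tau> g t = affine t 0 1 0"
    by (simp add: perm_eta_t_def affine_def pt_def mult.commute)
  moreover have "perm_pi G \<sigma> \<tau> = affine t 0 0 1"
    by (simp add: perm_pi_def affine_def pt_def int_pow_int)
  ultimately show ?thesis
    by (simp add: sub_Nopp_def generate_affine_group del: One_nat_def)
qed

lemma regular_affine_group: "regular_subgroup G (affine_group r s)"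
  unfolding regular_subgroup_iff
proof (intro conjI ballI impI)
  show "subgroup (affine_group r s) (Perm G)" by (rule subgroup_affine_group)
next
  fix x y assume xy: "x \<in> carrier G" "y \<in> carrier G"
  obtain k l where x: "x = pt (int k) l" using xy(1) by (rule carrier_pt)
  obtain k' l' where y: "y = pt (int k') l'" using xy(2) by (rule carrier_pt)
  obtain m where m: "[l + m = 0] (mod q)"
    using ex_additive_inverse by blast
  define K where "K = int k' - g ^ (s * (m + l')) * int k"
  have "[K * g ^ (r * m) * g ^ (r * l) = K] (mod int p)"
    using cong_scalar_left[OF g_power_inverse[OF m, of r], of K] by (simp add: ac_simps)
  from cong_add[OF cong_refl this, of "g ^ (s * (m + l')) * int k"]
  have "[g ^ (s * (m + l')) * int k + K * g ^ (r * m) * g ^ (r * l) = int k'] (mod int p)"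
    by (simp add: K_def)
  moreover have "[l + (m + l') = l'] (mod q)"
    using cong_add[OF m cong_refl, of l'] by (simp add: add.assoc)
  ultimately have "affine r s (K * g ^ (r * m)) (m + l') x = y"
    by (simp add: x y pt_eq_iff)
  then show "\<exists>\<nu>\<in>affine_group r s. \<nu> x = y" using affine_mem by blast
next
  fix \<nu> x assume \<nu>: "\<nu> \<in> affine_group r s" and x: "x \<in> carrier G" and fix_x: "\<nu> x = x"
  obtain a b where \<nu>: "\<nu> = affine r s a b" using \<nu> by (auto simp: affine_group_def)
  obtain k l where x: "x = pt (int k) l" using x by (rule carrier_pt)
  have eq: "[g ^ (s * b) * int k + a * g ^ (r * l) = int k] (mod int p)" "[l + b = l] (mod q)"
    using fix_x by (auto simp: \<nu> x pt_eq_iff)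
  have b: "[b = 0] (mod q)"
    using eq(2) by (simp add: cong_add_lcancel_0_nat)
  then have "[g ^ (s * b) = g ^ 0] (mod int p)"
    unfolding g_power_cong using cong_scalar_left[of b 0 q s] by simp
  then have "[g ^ (s * b) * int k = int k] (mod int p)"
    using cong_scalar_right by fastforce
  from cong_diff[OF eq(1) this] have "[a * g ^ (r * l) = 0] (mod int p)" by simp
  then have "[a = 0] (mod int p)"
    using g_power_nonzero[of "r * l"] prime_p by (simp add: cong_0_iff prime_dvd_mult_iff)
  then show "\<nu> = \<one>\<^bsub>Perm G\<^esub>"
    using b by (simp add: \<nu> affine_one[of r s] affine_eq_iff)
qed

section \<open>The action of \<open>G\<close> on both families\<close>

lemma G_act_affine_N:
  "G_act G (pt c d) (affine 0 t a b) = affine 0 t (g ^ d * a + (1 - g ^ (t * b)) * c) b"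
proof (rule G_act_eqI)
  fix y assume "y \<in> carrier G"
  then obtain k l where "y = pt (int k) l" by (rule carrier_pt)
  then show "pt c d \<otimes> affine 0 t a b y = affine 0 t (g ^ d * a + (1 - g ^ (t * b)) * c) b (pt c d \<otimes> y)"
    by (simp add: pt_mult algebra_simps)
qed (auto simp: affine_in_Perm)

text \<open>Here \<open>d'\<close> stands for \<open>- d\<close>, so that the scalar is \<open>g\<^sup>d\<^sup>(\<^sup>1\<^sup>-\<^sup>t\<^sup>)\<close>; exponents of \<open>\<tau>\<close> and of \<open>g\<close> are kept
  natural throughout.\<close>

lemma G_act_affine_Nopp:
  assumes "[d + d' = 0] (mod q)"
  shows "G_act G (pt c d) (affine t 0 a b) = affine t 0 (a * g ^ (d + t * d')) b"
proof (rule G_act_eqI)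
  fix y assume "y \<in> carrier G"
  then obtain k l where y: "y = pt (int k) l" by (rule carrier_pt)
  have "[g ^ (d + t * l) * (g ^ (t * d) * g ^ (t * d')) = g ^ (d + t * l) * 1] (mod int p)"
    by (rule cong_scalar_left[OF g_power_inverse[OF assms]])
  from cong_add[OF cong_refl cong_scalar_left[OF this, of a], of "c + g ^ d * int k"]
  show "pt c d \<otimes> affine t 0 a b y = affine t 0 (a * g ^ (d + t * d')) b (pt c d \<otimes> y)"
    by (simp add: y pt_mult pt_eq_iff power_add cong_sym_eq algebra_simps)
qed (auto simp: affine_in_Perm)

lemma G_stable_N: "G_stable G (affine_group 0 t)"
  unfolding G_stable_def
proof (intro ballI)
  fix x \<nu> assume x: "x \<in> carrier G" and "\<nu> \<in> affine_group 0 t"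
  then obtain a b where "\<nu> = affine 0 t a b" by (auto simp: affine_group_def)
  moreover obtain c d where "x = pt (int c) d" using x by (rule carrier_pt)
  ultimately show "G_act G x \<nu> \<in> affine_group 0 t"
    by (simp add: G_act_affine_N)
qed

lemma G_stable_Nopp: "G_stable G (affine_group t 0)"
  unfolding G_stable_def
proof (intro ballI)
  fix x \<nu> assume x: "x \<in> carrier G" and "\<nu> \<in> affine_group t 0"
  then obtain a b where "\<nu> = affine t 0 a b" by (auto simp: affine_group_def)
  moreover obtain c d where "x = pt (int c) d" using x by (rule carrier_pt)
  moreover obtain d' where "[d + d' = 0] (mod q)" using ex_additive_inverse by blast
  ultimately show "G_act G x \<nu> \<in> affine_group t 0"
    by (simp add: G_act_affine_Nopp)
qed

text \<open>The isomorphism is \<open>(a, b) \<mapsto> (a, s b)\<close> with \<open>t\<^sub>2 s \<equiv> t\<^sub>1\<close> modulo \<open>q\<close>. Both the product and the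
  \<open>G\<close>-action of \<open>N\<^sub>t\<close> depend on \<open>t\<close> only through \<open>g\<^sup>t\<^sup>b\<close>, and this choice of \<open>s\<close> gives
  the same power of \<open>g\<close> modulo \<open>p\<close> on both sides.\<close>

lemma G_isomorphic_N:
  assumes "coprime t1 q" "coprime t2 q"
  shows "G_isomorphic G (affine_group 0 t1) (affine_group 0 t2)"
proof -
  obtain w where w: "[t2 * w = 1] (mod q)" 
    using cong_solve_coprime_nat[OF assms(2)] by auto
  define s where "s = w * t1"
  have ts: "[t2 * s = t1] (mod q)"
    using cong_scalar_right[OF w, of t1] by (simp add: s_def mult.assoc)
  have s_coprime: "coprime s q"
    using w assms(1) by (auto simp: s_def dest: cong_imp_coprime[OF cong_sym])
  define \<theta> where "\<theta> \<nu> = (SOME \<mu>. \<exists>a b. \<nu> = affine 0 t1 a b \<and> \<mu> = affine 0 t2 a (s * b))" for \<nu>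
  have \<theta>: "\<theta> (affine 0 t1 a b) = affine 0 t2 a (s * b)" for a b
    unfolding \<theta>_def
  proof (rule some_equality)
    fix \<mu> assume "\<exists>a' b'. affine 0 t1 a b = affine 0 t1 a' b' \<and> \<mu> = affine 0 t2 a' (s * b')"
    then show "\<mu> = affine 0 t2 a (s * b)"
      by (auto simp: affine_eq_iff cong_sym cong_scalar_left)
  qed blast
  have t1_s: "[g ^ (t1 * b) = g ^ (t2 * (s * b))] (mod int p)" for b
    unfolding g_power_cong using cong_scalar_right[OF cong_sym[OF ts], of b] by (simp add: mult.assoc)
  have "\<theta> \<in> hom (Perm G\<lparr>carrier := affine_group 0 t1\<rparr>) (Perm G\<lparr>carrier := affine_group 0 t2\<rparr>)"
  proof (rule homI)
    fix \<mu> \<nu>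
    assume "\<mu> \<in> carrier (Perm G\<lparr>carrier := affine_group 0 t1\<rparr>)"
      "\<nu> \<in> carrier (Perm G\<lparr>carrier := affine_group 0 t1\<rparr>)"
    then obtain a b a' b' where \<mu>\<nu>: "\<mu> = affine 0 t1 a b" "\<nu> = affine 0 t1 a' b'"
      by (auto simp: affine_group_def)
    have "[g ^ (t1 * b) * a' + a = g ^ (t2 * (s * b)) * a' + a] (mod int p)"
      by (intro cong_add cong_scalar_right cong_refl t1_s)
    then show "\<theta> (\<mu> \<otimes>\<^bsub>Perm G\<lparr>carrier := affine_group 0 t1\<rparr>\<^esub> \<nu>)
        = \<theta> \<mu> \<otimes>\<^bsub>Perm G\<lparr>carrier := affine_group 0 t2\<rparr>\<^esub> \<theta> \<nu>"
      by (simp add: \<mu>\<nu> \<theta> affine_mult affine_eq_iff distrib_left)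
  qed (auto elim!: affine_groupE simp: \<theta>)
  moreover have "inj_on \<theta> (affine_group 0 t1)"
    using s_coprime by (auto intro!: inj_onI simp: affine_group_def \<theta> affine_eq_iff cong_mult_lcancel_nat)
  moreover have "\<theta> ` affine_group 0 t1 = affine_group 0 t2"
  proof (intro equalityI subsetI)
    fix \<mu> assume "\<mu> \<in> affine_group 0 t2"
    then obtain a b where \<mu>: "\<mu> = affine 0 t2 a b" by (auto simp: affine_group_def)
    obtain v where "[s * v = 1] (mod q)"
      using cong_solve_coprime_nat[OF s_coprime] by auto
    then have "[s * (v * b) = b] (mod q)"
      using cong_scalar_right[of "s * v" 1 q b] by (simp add: mult.assoc)
    then have "\<mu> = \<theta> (affine 0 t1 a (v * b))"
      by (simp add: \<mu> \<theta> affine_eq_iff cong_sym)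
    then show "\<mu> \<in> \<theta> ` affine_group 0 t1" by simp
  qed (auto elim!: affine_groupE simp: \<theta>)
  moreover have "\<theta> (G_act G x \<nu>) = G_act G x (\<theta> \<nu>)"
    if \<nu>: "\<nu> \<in> affine_group 0 t1" and x: "x \<in> carrier G" for x \<nu>
  proof -
    obtain a b where \<nu>: "\<nu> = affine 0 t1 a b" using \<nu> by (auto simp: affine_group_def)
    obtain c d where x: "x = pt (int c) d" using x by (rule carrier_pt)
    show ?thesis
      unfolding \<nu> x G_act_affine_N \<theta> affine_eq_iff
      by (intro conjI cong_add cong_scalar_right cong_diff cong_refl t1_s)
  qed
  ultimately have "\<theta> \<in> iso (Perm G\<lparr>carrier := affine_group 0 t1\<rparr>) (Perm G\<lparr>carrier := affine_group 0 t2\<rparr>)"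
    and "\<forall>\<nu>\<in>affine_group 0 t1. \<forall>x\<in>carrier G. \<theta> (G_act G x \<nu>) = G_act G x (\<theta> \<nu>)"
    by (simp_all add: iso_def bij_betw_def)
  then show ?thesis
    unfolding G_isomorphic_def using regular_affine_group G_stable_N by blast
qed

text \<open>As \<open>\<sigma>\<close> fixes every element of \<open>N\<^sup>o\<^sup>p\<^sup>p\<close>, it suffices to find an element of \<open>N\<close> that it moves:
  it multiplies \<open>\<pi>\<^sub>t\<close> by \<open>\<eta>\<close> to the power \<open>1 - g\<^sup>t\<close>, which is not divisible by \<open>p\<close>.\<close>

lemma not_G_isomorphic_N_Nopp:
  assumes "\<not> [t1 = 0] (mod q)"
  shows "\<not> G_isomorphic G (affine_group 0 t1) (affine_group t2 0)"
proof
  assume "G_isomorphic G (affine_group 0 t1) (affine_group t2 0)"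
  then obtain \<theta> where \<theta>: "\<theta> \<in> iso (Perm G\<lparr>carrier := affine_group 0 t1\<rparr>) (Perm G\<lparr>carrier := affine_group t2 0\<rparr>)"
    and equiv: "\<And>\<nu> x. \<nu> \<in> affine_group 0 t1 \<Longrightarrow> x \<in> carrier G \<Longrightarrow> \<theta> (G_act G x \<nu>) = G_act G x (\<theta> \<nu>)"
    unfolding G_isomorphic_def by blast
  have bij: "bij_betw \<theta> (affine_group 0 t1) (affine_group t2 0)"
    using \<theta> by (simp add: iso_def)
  let ?\<pi> = "affine 0 t1 0 1"
  have "\<theta> ?\<pi> \<in> affine_group t2 0"
    using bij bij_betw_apply by fastforce
  then have "G_act G (pt 1 0) (\<theta> ?\<pi>) = \<theta> ?\<pi>"
    using G_act_affine_Nopp[of 0 0 1 t2] by (auto simp: affine_group_def)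
  then have "\<theta> (G_act G (pt 1 0) ?\<pi>) = \<theta> ?\<pi>"
    using equiv by simp
  then have "affine 0 t1 (1 - g ^ t1) 1 = ?\<pi>"
    using bij by (auto simp: G_act_affine_N bij_betw_def dest: inj_onD)
  then have "[g ^ t1 = g ^ 0] (mod int p)"
    by (simp add: affine_eq_iff cong_iff_dvd_diff dvd_diff_commute)
  then show False using assms by (simp only: g_power_cong)
qed

lemma affine_pow: "\<exists>a'. affine r s a b [^]\<^bsub>Perm G\<^esub> (n::nat) = affine r s a' (n * b)"
proof (induction n)
  case 0
  then show ?case using affine_one by auto
next
  case (Suc n)
  then show ?case by (auto simp: affine_mult add.commute)
qed

lemma affine_translation_pow: "affine r s a 0 [^]\<^bsub>Perm G\<^esub> (n::nat) = affine r s (int n * a) 0"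
  by (induction n) (auto simp: affine_mult affine_one[of r s] algebra_simps)

text \<open>A \<open>G\<close>-isomorphism \<open>\<theta>\<close> sends \<open>\<eta>\<close> for \<open>t\<^sub>1\<close> to some \<open>(a, b)\<close>. Because \<open>\<eta>\<^sup>p = 1\<close> we have
  \<open>p b \<equiv> 0\<close> modulo \<open>q\<close> and so \<open>b \<equiv> 0\<close>. Comparing the action of \<open>\<tau>\<close> on \<open>\<eta>\<close> and on \<open>\<theta> \<eta>\<close> gives
  the same scalar modulo \<open>p\<close> on both sides.\<close>

lemma G_isomorphic_Nopp_imp_cong:
  assumes "G_isomorphic G (affine_group t1 0) (affine_group t2 0)"
  shows "[t1 = t2] (mod q)"
proof -
  let ?N1 = "Perm G\<lparr>carrier := affine_group t1 0\<rparr>" and ?N2 = "Perm G\<lparr>carrier := affine_group t2 0\<rparr>"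
  obtain \<theta> where \<theta>: "\<theta> \<in> iso ?N1 ?N2"
    and equiv: "\<And>\<nu> x. \<nu> \<in> affine_group t1 0 \<Longrightarrow> x \<in> carrier G \<Longrightarrow> \<theta> (G_act G x \<nu>) = G_act G x (\<theta> \<nu>)"
    using assms unfolding G_isomorphic_def by blast
  have bij: "bij_betw \<theta> (affine_group t1 0) (affine_group t2 0)"
    using \<theta> by (simp add: iso_def)
  have "group ?N1" "group ?N2"
    using subgroup_affine_group group.subgroup_imp_group[OF group_Perm] by auto
  moreover have "\<theta> \<in> hom ?N1 ?N2" using \<theta> by (simp add: iso_def)
  ultimately interpret \<theta>: group_hom ?N1 ?N2 \<theta>
    by (simp add: group_hom_def group_hom_axioms_def)
  let ?\<eta> = "affine t1 0 1 0"
  have pow: "\<theta> (?\<eta> [^]\<^bsub>Perm G\<^esub> n) = \<theta> ?\<eta> [^]\<^bsub>Perm G\<^esub> n" for n :: nat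
    using \<theta>.hom_nat_pow[of ?\<eta> n] monoid.nat_pow_consistent[OF group.is_monoid[OF group_Perm]] by simp
  have "\<theta> ?\<eta> \<in> affine_group t2 0"
    using bij bij_betw_apply by fastforce
  then obtain a b where ab: "\<theta> ?\<eta> = affine t2 0 a b"
    by (auto simp: affine_group_def)
  have one: "\<theta> (affine t1 0 0 0) = affine t2 0 0 0"
    using \<theta>.hom_one by (simp add: affine_one[of t1 0, symmetric] affine_one[of t2 0, symmetric])
  have "?\<eta> [^]\<^bsub>Perm G\<^esub> p = affine t1 0 0 0"
    by (simp add: affine_translation_pow affine_eq_iff cong_0_iff)
  then have "affine t2 0 a b [^]\<^bsub>Perm G\<^esub> p = affine t2 0 0 0"
    using pow[of p] one ab by simp
  then have "[p * b = 0] (mod q)"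
    using affine_pow[of t2 0 a b p] by (auto simp: affine_eq_iff cong_sym_eq)
  then have "q dvd b"
    using prime_p prime_q q_less_p by (auto simp: cong_0_iff prime_dvd_mult_iff dest: primes_dvd_imp_eq)
  then have \<theta>_\<eta>: "\<theta> ?\<eta> = affine t2 0 a 0"
    using ab by (simp add: affine_eq_iff cong_0_iff)
  have "\<not> [a = 0] (mod int p)"
  proof
    assume "[a = 0] (mod int p)"
    then have "\<theta> ?\<eta> = \<theta> (affine t1 0 0 0)"
      by (simp add: \<theta>_\<eta> one affine_eq_iff)
    then have "?\<eta> = affine t1 0 0 0"
      using bij by (auto simp: bij_betw_def dest: inj_onD)
    then show False
      using prime_p by (simp add: affine_eq_iff cong_0_iff)
  qed
  then have coprime: "coprime a (int p)"
    using prime_p by (metis cong_0_iff coprime_commute prime_imp_coprime prime_nat_int_transfer)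
  \<comment> \<open>With \<open>q - 1\<close> for \<open>- 1\<close> modulo \<open>q\<close>, the number \<open>e t\<close> is the exponent \<open>1 - t\<close>.\<close>
  define e where "e t = 1 + t * (q - 1)" for t
  have act: "G_act G (pt 0 1) (affine t 0 a' 0) = affine t 0 (a' * g ^ e t) 0" for t a'
    unfolding e_def by (rule G_act_affine_Nopp) (use q_pos in \<open>simp add: cong_0_iff\<close>)
  \<comment> \<open>On \<open>\<eta>\<close> the action of \<open>\<tau>\<close> is an \<open>m\<close>-th power, so \<open>\<theta>\<close> carries it to the \<open>m\<close>-th power of \<open>\<theta> \<eta>\<close>.\<close>
  define m where "m = nat (g ^ e t1 mod int p)"
  have m: "[int m = g ^ e t1] (mod int p)"
    using p_pos by (simp add: m_def cong_def)
  then have "G_act G (pt 0 1) ?\<eta> = ?\<eta> [^]\<^bsub>Perm G\<^esub> m"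
    by (simp add: act affine_translation_pow affine_eq_iff cong_sym del: One_nat_def)
  then have "affine t2 0 (a * g ^ e t2) 0 = affine t2 0 (int m * a) 0"
    using equiv[of ?\<eta> "pt 0 1"] pow[of m] by (simp add: \<theta>_\<eta> act affine_translation_pow del: One_nat_def)
  then have "[a * g ^ e t2 = a * int m] (mod int p)"
    by (simp add: affine_eq_iff mult.commute)
  then have "[g ^ e t2 = int m] (mod int p)"
    using coprime by (simp add: cong_mult_lcancel)
  then have "[e t2 = e t1] (mod q)"
    using m cong_trans g_power_cong by blast
  then have "[t2 * (q - 1) = t1 * (q - 1)] (mod q)"
    by (simp add: e_def cong_add_lcancel_nat del: One_nat_def)
  moreover have "coprime (q - 1) q"
    using q_pos coprime_diff_one_left_nat by blast
  ultimately show ?thesis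
    by (simp add: cong_mult_rcancel_nat cong_sym)
qed

text \<open>Conjugating \<open>\<tau>\<close> by \<open>\<sigma>\<^sup>c\<close> gives \<open>\<sigma>\<^sup>c\<^sup>(\<^sup>1\<^sup>-\<^sup>g\<^sup>) \<tau>\<close>, so \<open>c\<close> has to be an inverse of \<open>1 - g\<close> modulo \<open>p\<close>.\<close>

lemma automorphism_inner:
  assumes \<psi>: "\<psi> \<in> auto G" "\<psi> \<sigma> = \<sigma>" "\<psi> \<tau> = \<sigma> \<otimes> \<tau>" and g: "\<not> [g = 1] (mod int p)"
  obtains z where "z \<in> carrier G" "\<And>x. x \<in> carrier G \<Longrightarrow> \<psi> x = z \<otimes> x \<otimes> inv z"
proof -
  have "coprime (1 - g) (int p)"
    using g prime_p by (metis cong_iff_dvd_diff coprime_commute dvd_diff_commute prime_imp_coprime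
        prime_nat_int_transfer)
  then obtain c where c: "[(1 - g) * c = 1] (mod int p)"
    using cong_solve_coprime_int by blast
  define z where "z = \<sigma> [^] c"
  have z: "z \<in> carrier G" "inv z = pt (- c) 0" "z = pt c 0"
    by (simp_all add: z_def pt_def int_pow_neg)
  define \<iota> where "\<iota> x = z \<otimes> x \<otimes> inv z" for x
  have \<iota>_hom: "\<iota> \<in> hom G G"
    using conjugation_hom[OF z(1)] by (simp add: \<iota>_def[abs_def])
  have \<psi>_hom: "\<psi> \<in> hom G G" using \<psi> by (simp add: auto_def)
  have coords: "pt 1 0 = \<sigma>" "pt 0 1 = \<tau>" "pt 1 1 = \<sigma> \<otimes> \<tau>"
    by (simp_all add: pt_def)
  have \<iota>_pt: "\<iota> x = pt c 0 \<otimes> x \<otimes> pt (- c) 0" for x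
    unfolding \<iota>_def z(2) by (simp add: z(3))
  have "[c - g * c = 1] (mod int p)"
    using c by (simp add: left_diff_distrib)
  then have "\<iota> (pt 1 0) = pt 1 0" "\<iota> (pt 0 1) = pt 1 1"
    unfolding \<iota>_pt by (simp_all add: pt_mult pt_eq_iff)
  then have "\<iota> \<sigma> = \<psi> \<sigma>" "\<iota> \<tau> = \<psi> \<tau>"
    unfolding coords \<psi>(2,3) .
  then have "\<psi> (pt k l) = \<iota> (pt k l)" for k l
    using hom_int_pow[OF \<psi>_hom \<sigma>_closed is_group is_group] hom_int_pow[OF \<iota>_hom \<sigma>_closed is_group is_group]
      hom_nat_pow[OF \<psi>_hom \<tau>_closed is_group is_group] hom_nat_pow[OF \<iota>_hom \<tau>_closed is_group is_group]
    by (simp add: pt_def hom_mult[OF \<psi>_hom] hom_mult[OF \<iota>_hom])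
  then have "\<psi> x = \<iota> x" if "x \<in> carrier G" for x
    using that by (metis carrier_pt)
  then show ?thesis using that z(1) by (simp add: \<iota>_def)
qed

end

section \<open>The classification up to \<open>G\<close>-isomorphism\<close>

theorem proposition8p3:
  fixes G :: "('a, 'b) monoid_scheme" (structure)
    and p q :: nat and g :: int
    and \<sigma> \<tau> :: 'a and \<psi> :: "'a \<Rightarrow> 'a"
  assumes "prime p" and "prime q" and "p > q" and "q > 2"
    and "[p = 1] (mod q)"
    and "ord (int p) g = q"
    and "group G" and "\<not> comm_group G" and "order G = p * q"
    and "\<sigma> \<in> carrier G" and "\<tau> \<in> carrier G"
    and "group.ord G \<sigma> = p" and "group.ord G \<tau> = q"
    and "\<tau> \<otimes> \<sigma> \<otimes> inv \<tau> = \<sigma> [^] g"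
    and "carrier G = {\<sigma> [^] i \<otimes> \<tau> [^] j | i j :: nat. i \<le> p - 1 \<and> j \<le> q - 1}"
    and "\<psi> \<in> auto G" and "\<psi> \<sigma> = \<sigma>" and "\<psi> \<tau> = \<sigma> \<otimes> \<tau>"
  shows "(\<forall>t1\<in>{2..q - 1}. \<forall>t2\<in>{2..q - 1}. \<forall>u1\<in>{0..p - 1}. \<forall>u2\<in>{0..p - 1}.
            G_isomorphic G (N_tu G \<sigma> \<tau> g \<psi> t1 u1) (N_tu G \<sigma> \<tau> g \<psi> t2 u2)) \<and>
         (\<forall>t1\<in>{2..q - 1}. \<forall>t2\<in>{2..q - 1}. \<forall>u1\<in>{0..p - 1}. \<forall>u2\<in>{0..p - 1}.
            G_isomorphic G (Nopp_tu G \<sigma> \<tau> g \<psi> t1 u1) (Nopp_tu G \<sigma> \<tau> g \<psi> t2 u2) \<longleftrightarrow> t1 = t2) \<and>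
         (\<forall>t1\<in>{2..q - 1}. \<forall>t2\<in>{2..q - 1}. \<forall>u1\<in>{0..p - 1}. \<forall>u2\<in>{0..p - 1}.
            \<not> G_isomorphic G (N_tu G \<sigma> \<tau> g \<psi> t1 u1) (Nopp_tu G \<sigma> \<tau> g \<psi> t2 u2))"
proof -
  interpret order_pq_group G p q g \<sigma> \<tau>
    using assms by (simp add: order_pq_group_def order_pq_group_axioms_def)
  have "\<not> [1 = 0] (mod q)"
    using \<open>q > 2\<close> by (simp add: cong_def)
  then have "\<not> [g = 1] (mod int p)"
    using g_power_cong[of 1 0] by simp
  then obtain z where z: "z \<in> carrier G" "\<And>x. x \<in> carrier G \<Longrightarrow> \<psi> x = z \<otimes> x \<otimes> inv z"
    using automorphism_inner[OF \<open>\<psi> \<in> auto G\<close> \<open>\<psi> \<sigma> = \<sigma>\<close> \<open>\<psi> \<tau> = \<sigma> \<otimes> \<tau>\<close>] by metis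
  have \<psi>_Perm: "\<psi> \<in> carrier (Perm G)"
    using \<open>\<psi> \<in> auto G\<close> by (simp add: auto_def Perm_def BijGroup_def)
  have N: "G_isomorphic G (affine_group 0 t) (N_tu G \<sigma> \<tau> g \<psi> t u)" for t u
    unfolding N_tu_def sub_N_eq
    by (rule G_isomorphic_conj_pow[OF regular_affine_group G_stable_N \<psi>_Perm z])
  have Nopp: "G_isomorphic G (affine_group t 0) (Nopp_tu G \<sigma> \<tau> g \<psi> t u)" for t u
    unfolding Nopp_tu_def sub_Nopp_eq
    by (rule G_isomorphic_conj_pow[OF regular_affine_group G_stable_Nopp \<psi>_Perm z])
  have t_less: "0 < t" "t < q" if "t \<in> {2..q - 1}" for t
    using that \<open>q > 2\<close> by auto
  have t_coprime: "coprime t q" if "t \<in> {2..q - 1}" for t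
    using t_less[OF that] \<open>prime q\<close> by (metis coprime_commute nat_dvd_not_less prime_imp_coprime)
  have "G_isomorphic G (N_tu G \<sigma> \<tau> g \<psi> t1 u1) (N_tu G \<sigma> \<tau> g \<psi> t2 u2)"
    if "t1 \<in> {2..q - 1}" "t2 \<in> {2..q - 1}" for t1 t2 u1 u2
    using G_isomorphic_N[OF t_coprime[OF that(1)] t_coprime[OF that(2)]]
      N G_isomorphic_sym G_isomorphic_trans by blast
  moreover have "G_isomorphic G (Nopp_tu G \<sigma> \<tau> g \<psi> t1 u1) (Nopp_tu G \<sigma> \<tau> g \<psi> t2 u2) \<longleftrightarrow> t1 = t2"
    if "t1 \<in> {2..q - 1}" "t2 \<in> {2..q - 1}" for t1 t2 u1 u2
  proof
    assume "G_isomorphic G (Nopp_tu G \<sigma> \<tau> g \<psi> t1 u1) (Nopp_tu G \<sigma> \<tau> g \<psi> t2 u2)"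
    then have "G_isomorphic G (affine_group t1 0) (affine_group t2 0)"
      using Nopp G_isomorphic_sym G_isomorphic_trans by blast
    then show "t1 = t2"
      using G_isomorphic_Nopp_imp_cong t_less that cong_less_modulus_unique_nat by blast
  next
    assume "t1 = t2"
    then show "G_isomorphic G (Nopp_tu G \<sigma> \<tau> g \<psi> t1 u1) (Nopp_tu G \<sigma> \<tau> g \<psi> t2 u2)"
      using Nopp G_isomorphic_sym G_isomorphic_trans by blast
  qed
  moreover have "\<not> G_isomorphic G (N_tu G \<sigma> \<tau> g \<psi> t1 u1) (Nopp_tu G \<sigma> \<tau> g \<psi> t2 u2)"
    if "t1 \<in> {2..q - 1}" for t1 t2 u1 u2
  proof
    assume "G_isomorphic G (N_tu G \<sigma> \<tau> g \<psi> t1 u1) (Nopp_tu G \<sigma> \<tau> g \<psi> t2 u2)"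
    then have "G_isomorphic G (affine_group 0 t1) (affine_group t2 0)"
      using N Nopp G_isomorphic_sym G_isomorphic_trans by blast
    moreover have "\<not> [t1 = 0] (mod q)"
      using t_less[OF that] by (auto simp: cong_0_iff dest: dvd_imp_le)
    ultimately show False
      using not_G_isomorphic_N_Nopp by blast
  qed
  ultimately show ?thesis by blast
qed

end
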